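(* Let $H:\mathbb{R}\times\mathbb{R}^d\times\mathbb{R}^d\to\mathbb{R}$ be continuous, let $T>0$, and let $f^-,f^+:\,]0,T[\times\mathbb{R}^d\to\mathbb{R}$ be two $C^2$ solutions of the Hamilton-Jacobi equation $\partial_tf(t,x)+H(t,x,\partial_xf(t,x))=0$ with bounded second derivative and bounded derivative. The function $u:=\min(f^-,f^+)$ is a viscosity solution of this equation if and only if the entropy condition $$H(t,x,sp^-+(1-s)p^+)\leq sH(t,x,p^-)+(1-s)H(t,x,p^+)\qquad\forall s\in[0,1],$$ where $p^\pm=\partial_xf^\pm(t,x)$, is satisfied at each point $(t,x)\in\,]0,T[\times\mathbb{R}^d$.
   Context: A function $u:\,]0,T[\times\mathbb{R}^d\to\mathbb{R}$ is a viscosity solution of $\partial_tu+H(t,x,\partial_xu)=0$ if each smooth function $\phi$ having a contact from above (resp. from below) with $u$ at some point $(t_0,x_0)\in\,]0,T[\times\mathbb{R}^d$ satisfies $\partial_t\phi(t_0,x_0)+H(t_0,x_0,\partial_x\phi(t_0,x_0))\leq0$ (resp. $\geq0$). Contact from above means $\phi(t_0,x_0)=u(t_0,x_0)$ and $\phi\geq u$; contact from below means $\phi(t_0,x_0)=u(t_0,x_0)$ and $\phi\leq u$.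
   Formalization: The entropy condition is required only at points (t,x) where f^-(t,x)=f^+(t,x); demanded at every point, the "only if" fails, e.g. d=1, f^-=sin x, f^+=2, H=p(cos x - p), where min(f^-,f^+)=sin x is a classical solution. *)

theory Defs
  imports "HOL-Analysis.Analysis"
begin

definition spacetime :: "real \<Rightarrow> (real \<times> (real ^ 'd)) set" where
  "spacetime T = {0<..<T} \<times> UNIV"

text \<open>
  Functions on \<open>spacetime T\<close> are represented by total functions. Since \<open>spacetime T\<close> is open,
  none of the notions below depends on values outside it.
\<close>

text \<open>
  \<open>Ck_on k S f\<close>, for open \<open>S\<close>: \<open>f\<close> is of class \<open>C\<^sup>k\<close> on \<open>S\<close>, i.e. all its iterated directional
  derivatives up to order \<open>k\<close> exist and are continuous (equivalently, in finite dimension, \<open>f\<close> is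
  \<open>k\<close> times continuously Frechet differentiable).
\<close>

primrec Ck_on :: "nat \<Rightarrow> 'a::euclidean_space set \<Rightarrow> ('a \<Rightarrow> real) \<Rightarrow> bool" where
  "Ck_on 0 S f \<longleftrightarrow> continuous_on S f"
| "Ck_on (Suc k) S f \<longleftrightarrow>
     (\<forall>z\<in>S. f differentiable (at z)) \<and> (\<forall>v. Ck_on k S (\<lambda>z. frechet_derivative f (at z) v))"

definition smooth_on :: "'a::euclidean_space set \<Rightarrow> ('a \<Rightarrow> real) \<Rightarrow> bool" where
  "smooth_on S f \<longleftrightarrow> (\<forall>k. Ck_on k S f)"

definition second_derivative :: "('a::euclidean_space \<Rightarrow> real) \<Rightarrow> 'a \<Rightarrow> 'a \<Rightarrow> 'a \<Rightarrow> real" where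
  "second_derivative f z v w =
     frechet_derivative (\<lambda>y. frechet_derivative f (at y) v) (at z) w"

text \<open>The derivatives are those in all variables \<open>(t, x)\<close>, bounded as linear and bilinear forms.\<close>

definition bounded_derivative_on :: "'a::euclidean_space set \<Rightarrow> ('a \<Rightarrow> real) \<Rightarrow> bool" where
  "bounded_derivative_on S f \<longleftrightarrow>
     (\<exists>C. \<forall>z\<in>S. \<forall>v. \<bar>frechet_derivative f (at z) v\<bar> \<le> C * norm v)"

definition bounded_second_derivative_on :: "'a::euclidean_space set \<Rightarrow> ('a \<Rightarrow> real) \<Rightarrow> bool" where
  "bounded_second_derivative_on S f \<longleftrightarrow>
     (\<exists>C. \<forall>z\<in>S. \<forall>v w. \<bar>second_derivative f z v w\<bar> \<le> C * norm v * norm w)"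

definition dt :: "(real \<times> (real ^ 'd) \<Rightarrow> real) \<Rightarrow> real \<Rightarrow> real ^ 'd \<Rightarrow> real" where
  "dt f t x = deriv (\<lambda>\<tau>. f (\<tau>, x)) t"

text \<open>The differential in \<open>x\<close>, identified with the gradient vector.\<close>

definition dx :: "(real \<times> (real ^ 'd) \<Rightarrow> real) \<Rightarrow> real \<Rightarrow> real ^ 'd \<Rightarrow> real ^ 'd" where
  "dx f t x = (THE p. ((\<lambda>y. f (t, y)) has_derivative (\<lambda>h. p \<bullet> h)) (at x))"

definition HJ_solution ::
    "real \<Rightarrow> (real \<Rightarrow> real ^ 'd \<Rightarrow> real ^ 'd \<Rightarrow> real) \<Rightarrow> (real \<times> (real ^ 'd) \<Rightarrow> real) \<Rightarrow> bool" where
  "HJ_solution T H f \<longleftrightarrow> (\<forall>(t, x) \<in> spacetime T. dt f t x + H t x (dx f t x) = 0)"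

definition contact_above ::
    "real \<Rightarrow> (real \<times> (real ^ 'd) \<Rightarrow> real) \<Rightarrow> (real \<times> (real ^ 'd) \<Rightarrow> real) \<Rightarrow> real \<times> (real ^ 'd) \<Rightarrow> bool" where
  "contact_above T \<phi> u z \<longleftrightarrow> \<phi> z = u z \<and> (\<forall>y\<in>spacetime T. \<phi> y \<ge> u y)"

definition contact_below ::
    "real \<Rightarrow> (real \<times> (real ^ 'd) \<Rightarrow> real) \<Rightarrow> (real \<times> (real ^ 'd) \<Rightarrow> real) \<Rightarrow> real \<times> (real ^ 'd) \<Rightarrow> bool" where
  "contact_below T \<phi> u z \<longleftrightarrow> \<phi> z = u z \<and> (\<forall>y\<in>spacetime T. \<phi> y \<le> u y)"

definition viscosity_solution ::
    "real \<Rightarrow> (real \<Rightarrow> real ^ 'd \<Rightarrow> real ^ 'd \<Rightarrow> real) \<Rightarrow> (real \<times> (real ^ 'd) \<Rightarrow> real) \<Rightarrow> bool" where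
  "viscosity_solution T H u \<longleftrightarrow>
     (\<forall>\<phi>. smooth_on (spacetime T) \<phi> \<longrightarrow>
        (\<forall>(t, x) \<in> spacetime T.
           (contact_above T \<phi> u (t, x) \<longrightarrow> dt \<phi> t x + H t x (dx \<phi> t x) \<le> 0) \<and>
           (contact_below T \<phi> u (t, x) \<longrightarrow> dt \<phi> t x + H t x (dx \<phi> t x) \<ge> 0)))"

text \<open>
  The entropy inequality at \<open>(t, x)\<close> for the gradients \<open>p, q\<close> of the two branches. For
  \<open>u = min f g\<close> it is to be imposed at the points where both branches are active, that is
  \<open>f = g\<close>. Elsewhere \<open>u\<close> coincides locally with one classical solution and is unaffected by the
  gradient of the other: with \<open>d = 1\<close>, \<open>f = sin x\<close>, \<open>g = 2\<close>, \<open>H t x p = p * (cos x - p)\<close>,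
  \<open>min f g = f\<close> is a classical solution although the inequality fails wherever \<open>cos x \<noteq> 0\<close>.
\<close>

definition entropy_condition ::
    "(real \<Rightarrow> real ^ 'd \<Rightarrow> real ^ 'd \<Rightarrow> real) \<Rightarrow> real \<Rightarrow> real ^ 'd \<Rightarrow> real ^ 'd \<Rightarrow> real ^ 'd \<Rightarrow> bool" where
  "entropy_condition H t x p q \<longleftrightarrow>
     (\<forall>s\<in>{0..1}. H t x (s *\<^sub>R p + (1 - s) *\<^sub>R q) \<le> s * H t x p + (1 - s) * H t x q)"

end

theory Submission
  imports Defs
begin

text \<open>
  A function touching \<open>min f g\<close> from above at a point where \<open>f = g\<close> has its differential on the
  segment between those of \<open>f\<close> and \<open>g\<close>, since otherwise a separating hyperplane gives a direction
  in which both branches grow faster; the equation is affine in the time derivative, so the entropy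
  condition yields the subsolution inequality. Conversely, by Taylor's formula and the bound on the second
  derivatives, each convex combination of the two differentials is the differential of a paraboloid
  lying above the same convex combination of \<open>f\<close> and \<open>g\<close>, hence above \<open>min f g\<close>.
\<close>

section \<open>Space-time gradients and contact with a minimum of two functions\<close>

lemma dt_dx_eqI:
  fixes f :: "real \<times> (real ^ 'd) \<Rightarrow> real"
  assumes "(f has_derivative (\<lambda>v. l \<bullet> v)) (at (t, x))"
  shows "dt f t x = fst l" "dx f t x = snd l"
proof -
  have "((\<lambda>\<tau>. f (\<tau>, x)) has_derivative (\<lambda>h. l \<bullet> (h, 0))) (at t)"
    by (rule has_derivative_compose[where g = f, of "\<lambda>\<tau>. (\<tau>, x)"])
       (use assms in \<open>auto intro!: derivative_eq_intros\<close>)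
  then have "((\<lambda>\<tau>. f (\<tau>, x)) has_field_derivative fst l) (at t)"
    by (simp add: has_field_derivative_def inner_prod_def)
  then show "dt f t x = fst l"
    unfolding dt_def by (rule DERIV_imp_deriv)
  have "((\<lambda>y. f (t, y)) has_derivative (\<lambda>h. l \<bullet> (0, h))) (at x)"
    by (rule has_derivative_compose[where g = f, of "\<lambda>y. (t, y)"])
       (use assms in \<open>auto intro!: derivative_eq_intros\<close>)
  then have D: "((\<lambda>y. f (t, y)) has_derivative (\<lambda>h. snd l \<bullet> h)) (at x)"
    by (simp add: inner_prod_def)
  show "dx f t x = snd l"
    unfolding dx_def
  proof (rule the_equality)
    fix p
    assume "((\<lambda>y. f (t, y)) has_derivative (\<lambda>h. p \<bullet> h)) (at x)"
    with D have "(\<lambda>h. p \<bullet> h) = (\<lambda>h. snd l \<bullet> h)"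
      using has_derivative_unique by blast
    then show "p = snd l"
      by (metis vector_eq_rdot)
  qed (fact D)
qed

lemma has_derivative_dt_dx:
  fixes f :: "real \<times> (real ^ 'd) \<Rightarrow> real"
  assumes "f differentiable (at (t, x))"
  shows "(f has_derivative (\<lambda>v. (dt f t x, dx f t x) \<bullet> v)) (at (t, x))"
proof -
  obtain D where D: "(f has_derivative D) (at (t, x))"
    using assms by (auto simp: differentiable_def)
  then have "linear D"
    by (rule has_derivative_linear)
  \<comment> \<open>The adjoint of a linear functional, evaluated at 1, is its Riesz
    representative.\<close>
  then have "D = (\<lambda>v. adjoint D 1 \<bullet> v)"
    using adjoint_works[of D] by (simp add: fun_eq_iff inner_commute)
  with D have "(f has_derivative (\<lambda>v. adjoint D 1 \<bullet> v)) (at (t, x))"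
    by simp
  with dt_dx_eqI[OF this] show ?thesis
    by simp
qed

text \<open>Besides the contact with a true minimum, this covers a single touching function: for
  \<open>f = g\<close> the segment is a point and the two differentials agree. Exchanging the
  touching functions then treats contact from below. The inequality is only asked on an open
  \<open>S\<close>, so the lemma applies locally.\<close>

lemma derivative_of_contact_above_min:
  fixes f g \<phi> :: "'a::euclidean_space \<Rightarrow> real"
  assumes "open S" "z \<in> S"
    and f: "(f has_derivative (\<lambda>v. a \<bullet> v)) (at z)"
    and g: "(g has_derivative (\<lambda>v. b \<bullet> v)) (at z)"
    and \<phi>: "(\<phi> has_derivative (\<lambda>v. l \<bullet> v)) (at z)"
    and eq: "f z = \<phi> z" "g z = \<phi> z"
    and le: "\<And>y. y \<in> S \<Longrightarrow> min (f y) (g y) \<le> \<phi> y"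
  shows "l \<in> closed_segment a b"
proof (rule ccontr)
  assume "l \<notin> closed_segment a b"
  then obtain v \<beta> where v: "v \<bullet> l < \<beta>" "\<And>p. p \<in> closed_segment a b \<Longrightarrow> \<beta> < v \<bullet> p"
    using separating_hyperplane_closed_point[of "closed_segment a b" l] by auto
  have grow: "\<exists>d>0. \<forall>r>0. r < d \<longrightarrow> \<phi> (z + r *\<^sub>R v) < k (z + r *\<^sub>R v)"
    if k: "(k has_derivative (\<lambda>v. c \<bullet> v)) (at z)" and "k z = \<phi> z" and "c \<in> closed_segment a b"
    for k c
  proof -
    \<comment> \<open>The base point is written \<open>z + 0 *\<^sub>R v\<close> to match the line
      \<open>r \<mapsto> z + r *\<^sub>R v\<close> at \<open>r = 0\<close> in the chain
      rule.\<close>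
    have "((\<lambda>y. k y - \<phi> y) has_derivative (\<lambda>v. c \<bullet> v - l \<bullet> v)) (at (z + 0 *\<^sub>R v))"
      using has_derivative_diff[OF k \<phi>] by simp
    then have "((\<lambda>r. k (z + r *\<^sub>R v) - \<phi> (z + r *\<^sub>R v)) has_derivative
        (\<lambda>h. c \<bullet> (h *\<^sub>R v) - l \<bullet> (h *\<^sub>R v))) (at (0::real))"
      by (rule has_derivative_compose[where g = "\<lambda>y. k y - \<phi> y", of "\<lambda>r. z + r *\<^sub>R v", rotated])
         (auto intro!: derivative_eq_intros)
    then have "((\<lambda>r. k (z + r *\<^sub>R v) - \<phi> (z + r *\<^sub>R v)) has_real_derivative (v \<bullet> c - v \<bullet> l)) (at 0)"
      unfolding has_field_derivative_def
      by (rule has_derivative_eq_rhs) (auto simp: inner_commute algebra_simps)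
    moreover have "v \<bullet> c - v \<bullet> l > 0"
      using v(1) v(2)[OF that(3)] by simp
    ultimately show ?thesis
      using DERIV_pos_inc_right[of "\<lambda>r. k (z + r *\<^sub>R v) - \<phi> (z + r *\<^sub>R v)"] that(2) by fastforce
  qed
  obtain d1 where d1: "d1 > 0" "\<And>r. 0 < r \<Longrightarrow> r < d1 \<Longrightarrow> \<phi> (z + r *\<^sub>R v) < f (z + r *\<^sub>R v)"
    using grow[OF f eq(1)] by auto
  obtain d2 where d2: "d2 > 0" "\<And>r. 0 < r \<Longrightarrow> r < d2 \<Longrightarrow> \<phi> (z + r *\<^sub>R v) < g (z + r *\<^sub>R v)"
    using grow[OF g eq(2)] by auto
  have "open ((\<lambda>r::real. z + r *\<^sub>R v) -` S)"
    by (intro continuous_open_vimage \<open>open S\<close> continuous_intros)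
  moreover have "0 \<in> (\<lambda>r::real. z + r *\<^sub>R v) -` S"
    using \<open>z \<in> S\<close> by simp
  ultimately obtain d3 where "d3 > 0" "\<forall>r. dist r 0 < d3 \<longrightarrow> r \<in> (\<lambda>r. z + r *\<^sub>R v) -` S"
    unfolding open_dist by blast
  then have d3: "d3 > 0" "\<And>r. \<bar>r\<bar> < d3 \<Longrightarrow> z + r *\<^sub>R v \<in> S"
    by (simp_all add: dist_real_def)
  \<comment> \<open>At this step length both branches exceed \<open>\<phi>\<close> and the point is
    still in \<open>S\<close>, against \<open>le\<close>.\<close>
  define r where "r = min d1 (min d2 d3) / 2"
  have "0 < r" "r < d1" "r < d2" "\<bar>r\<bar> < d3"
    using d1(1) d2(1) d3(1) by (auto simp: r_def)
  then show False
    using d1(2)[of r] d2(2)[of r] le[OF d3(2)[of r]] by simp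
qed

section \<open>Paraboloids as smooth test functions, and the Taylor bound\<close>

lemma Ck_on_const: "Ck_on k S (\<lambda>_. c)"
proof (induction k arbitrary: c)
  case (Suc k)
  have "frechet_derivative (\<lambda>_. c) (at z) = (\<lambda>_. 0)" for z :: 'a
    by (rule frechet_derivative_at[symmetric]) simp
  with Suc show ?case
    by simp
qed simp

lemma Ck_on_affine: "Ck_on k S (\<lambda>y. c + l \<bullet> (y - z))"
proof (cases k)
  case (Suc j)
  have D: "((\<lambda>y. c + l \<bullet> (y - z)) has_derivative (\<lambda>v. l \<bullet> v)) (at y)" for y
    by (auto intro!: derivative_eq_intros)
  show ?thesis
    using D by (auto simp: Suc Ck_on_const frechet_derivative_at[OF D, symmetric] differentiable_def)
qed (auto intro!: continuous_intros)

lemma paraboloid_has_derivative: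
  "((\<lambda>y. c + l \<bullet> (y - z) + C * ((y - z) \<bullet> (y - z))) has_derivative
     (\<lambda>v. (l + (2 * C) *\<^sub>R (y - z)) \<bullet> v)) (at y)"
  by (rule derivative_eq_intros refl | simp)+ (auto simp: algebra_simps inner_commute)

text \<open>In each fixed direction the derivative of a paraboloid is affine in the base point, so
  \<open>Ck_on_affine\<close> supplies all higher orders.\<close>

lemma smooth_on_paraboloid: "smooth_on S (\<lambda>y. c + l \<bullet> (y - z) + C * ((y - z) \<bullet> (y - z)))"
proof -
  note D = paraboloid_has_derivative[of c l z C]
  have "Ck_on k S (\<lambda>y. c + l \<bullet> (y - z) + C * ((y - z) \<bullet> (y - z)))" for k
  proof (cases k)
    case (Suc j)
    have "(\<lambda>y. frechet_derivative (\<lambda>y. c + l \<bullet> (y - z) + C * ((y - z) \<bullet> (y - z))) (at y) v) =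
        (\<lambda>y. l \<bullet> v + ((2 * C) *\<^sub>R v) \<bullet> (y - z))" for v
      unfolding frechet_derivative_at[OF D, symmetric] by (simp add: algebra_simps inner_commute)
    then show ?thesis
      \<comment> \<open>The scalar must stay inside the inner product for
        \<open>Ck_on_affine\<close> to match.\<close>
      using D by (auto simp: Suc Ck_on_affine differentiable_def simp del: inner_scaleR_left)
  qed (auto intro!: continuous_intros)
  then show ?thesis
    by (simp add: smooth_on_def)
qed

text \<open>Second-order Taylor expansion with Lagrange remainder along the segment from
  \<open>z\<close> to \<open>y\<close>, which convexity keeps inside \<open>S\<close>.\<close>

lemma paraboloid_bound:
  fixes f :: "'a::euclidean_space \<Rightarrow> real"
  assumes "convex S" "Ck_on 2 S f" "z \<in> S" "y \<in> S"
    and l: "(f has_derivative (\<lambda>v. l \<bullet> v)) (at z)"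
    and C: "\<And>z v w. z \<in> S \<Longrightarrow> \<bar>second_derivative f z v w\<bar> \<le> C * norm v * norm w"
  shows "f y \<le> f z + l \<bullet> (y - z) + C * ((y - z) \<bullet> (y - z))"
proof -
  define v where "v = y - z"
  define p where "p r = z + r *\<^sub>R v" for r :: real
  \<comment> \<open>The restriction of \<open>f\<close> to the segment and its first two
    derivatives, indexed as \<open>Taylor_up\<close> expects; the last branch only matters at index
    2.\<close>
  define F where "F n r = (if n = 0 then f (p r) else if n = 1 then frechet_derivative f (at (p r)) v
      else second_derivative f (p r) v v)" for n :: nat and r
  have p: "p r \<in> S" if "0 \<le> r" "r \<le> 1" for r
  proof -
    have "p r = (1 - r) *\<^sub>R z + r *\<^sub>R y"
      by (simp add: p_def v_def algebra_simps)
    with that assms(1,3,4) show ?thesis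
      by (simp add: convex_alt)
  qed
  have diff: "f differentiable (at x)" "(\<lambda>y. frechet_derivative f (at y) v) differentiable (at x)"
    if "x \<in> S" for x
    using assms(2) that by (simp_all add: numeral_2_eq_2)
  have along: "((\<lambda>r. k (p r)) has_real_derivative frechet_derivative k (at (p r)) v) (at r)"
    if "k differentiable (at (p r))" for k :: "'a \<Rightarrow> real" and r
  proof -
    have D: "(k has_derivative frechet_derivative k (at (p r))) (at (p r))"
      using that by (simp add: frechet_derivative_works)
    have "((\<lambda>r. k (p r)) has_derivative (\<lambda>h. frechet_derivative k (at (p r)) (h *\<^sub>R v))) (at r)"
      by (rule has_derivative_compose[where g = k, of p, OF _ D])
         (auto simp: p_def[abs_def] intro!: derivative_eq_intros)
    then show ?thesis
      unfolding has_field_derivative_def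
      by (rule has_derivative_eq_rhs)
         (auto simp: linear_cmul[OF has_derivative_linear[OF D]] mult.commute)
  qed
  have "\<forall>m r. m < 2 \<and> 0 \<le> r \<and> r \<le> 1 \<longrightarrow> (F m has_real_derivative F (Suc m) r) (at r)"
    using along[OF diff(1)[OF p]] along[OF diff(2)[OF p]]
    by (auto simp: F_def[abs_def] second_derivative_def less_2_cases_iff)
  then obtain \<theta> where \<theta>: "0 < \<theta>" "\<theta> < 1"
    and "F 0 1 = (\<Sum>m<2. F m 0 / fact m * (1 - 0) ^ m) + F 2 \<theta> / fact 2 * (1 - 0) ^ 2"
    using Taylor_up[of 2 F "F 0" 0 1 0] by auto
  then have "f y = f z + frechet_derivative f (at z) v + second_derivative f (p \<theta>) v v / 2"
    by (simp add: F_def p_def v_def numeral_2_eq_2)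
  moreover have "frechet_derivative f (at z) v = l \<bullet> v"
    using frechet_derivative_at[OF l] by simp
  moreover have "\<bar>second_derivative f (p \<theta>) v v\<bar> \<le> C * (v \<bullet> v)"
    using C[OF p, of \<theta> v v] \<theta> by (simp add: dot_square_norm power2_eq_square mult.assoc)
  ultimately show ?thesis
    unfolding v_def[symmetric] by linarith
qed

section \<open>Equivalence of the viscosity and entropy conditions\<close>

theorem corollary1:
  fixes H :: "real \<Rightarrow> real ^ 'd \<Rightarrow> real ^ 'd \<Rightarrow> real"
    and T :: real
    and fm fp :: "real \<times> (real ^ 'd) \<Rightarrow> real"
  assumes "continuous_on UNIV (\<lambda>(t, x, p). H t x p)"
    and "T > 0"
    and "Ck_on 2 (spacetime T) fm" and "Ck_on 2 (spacetime T) fp"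
    and "HJ_solution T H fm" and "HJ_solution T H fp"
    and "bounded_derivative_on (spacetime T) fm" and "bounded_derivative_on (spacetime T) fp"
    and "bounded_second_derivative_on (spacetime T) fm"
    and "bounded_second_derivative_on (spacetime T) fp"
  shows "viscosity_solution T H (\<lambda>z. min (fm z) (fp z)) \<longleftrightarrow>
    (\<forall>(t, x) \<in> spacetime T. fm (t, x) = fp (t, x) \<longrightarrow>
       entropy_condition H t x (dx fm t x) (dx fp t x))"
proof -
  let ?S = "spacetime T :: (real \<times> (real ^ 'd)) set"
  let ?u = "\<lambda>z. min (fm z) (fp z)"
  have S: "open ?S" "convex ?S"
    by (auto simp: spacetime_def intro!: open_Times convex_Times)
  have diff: "fm differentiable (at z)" "fp differentiable (at z)" if "z \<in> ?S" for z
    using assms(3,4) that by (simp_all add: numeral_2_eq_2)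
  note Dm = has_derivative_dt_dx[OF diff(1)] and Dp = has_derivative_dt_dx[OF diff(2)]
  have HJ: "dt fm t x + H t x (dx fm t x) = 0" "dt fp t x + H t x (dx fp t x) = 0"
    if "(t, x) \<in> ?S" for t x
    using assms(5,6) that by (auto simp: HJ_solution_def)
  show ?thesis
  proof (intro iffI ballI, safe)
    fix t x
    assume visc: "viscosity_solution T H ?u" and z: "(t, x) \<in> ?S" and eq: "fm (t, x) = fp (t, x)"
    obtain C1 where C1: "\<And>z v w. z \<in> ?S \<Longrightarrow> \<bar>second_derivative fm z v w\<bar> \<le> C1 * norm v * norm w"
      using assms(9) unfolding bounded_second_derivative_on_def by blast
    obtain C2 where C2: "\<And>z v w. z \<in> ?S \<Longrightarrow> \<bar>second_derivative fp z v w\<bar> \<le> C2 * norm v * norm w"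
      using assms(10) unfolding bounded_second_derivative_on_def by blast
    show "entropy_condition H t x (dx fm t x) (dx fp t x)"
      unfolding entropy_condition_def
    proof
      fix s :: real
      assume s: "s \<in> {0..1}"
      define a where "a = (dt fm t x, dx fm t x)"
      define b where "b = (dt fp t x, dx fp t x)"
      define l where "l = s *\<^sub>R a + (1 - s) *\<^sub>R b"
      \<comment> \<open>The weights of \<open>l\<close> also combine the curvature bounds. As
        \<open>fm\<close> and \<open>fp\<close> agree at \<open>(t, x)\<close>, the weighted sum of
        the two bounding paraboloids is then exactly \<open>\<phi>\<close>.\<close>
      define C where "C = s * C1 + (1 - s) * C2"
      define \<phi> where "\<phi> y = fm (t, x) + l \<bullet> (y - (t, x)) + C * ((y - (t, x)) \<bullet> (y - (t, x)))" for y
      have "?u y \<le> \<phi> y" if y: "y \<in> ?S" for y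
      proof -
        let ?v = "y - (t, x)"
        have 1: "fm y \<le> fm (t, x) + a \<bullet> ?v + C1 * (?v \<bullet> ?v)"
          unfolding a_def by (rule paraboloid_bound[OF S(2) assms(3) z y Dm[OF z] C1])
        have 2: "fp y \<le> fp (t, x) + b \<bullet> ?v + C2 * (?v \<bullet> ?v)"
          unfolding b_def by (rule paraboloid_bound[OF S(2) assms(4) z y Dp[OF z] C2])
        \<comment> \<open>Splitting the minimum with the same weights allows each share to be
          bounded by a different branch.\<close>
        have "?u y = s * ?u y + (1 - s) * ?u y"
          by (simp add: algebra_simps)
        also have "\<dots> \<le> s * (fm (t, x) + a \<bullet> ?v + C1 * (?v \<bullet> ?v))
            + (1 - s) * (fp (t, x) + b \<bullet> ?v + C2 * (?v \<bullet> ?v))"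
          using s 1 2 by (intro add_mono mult_left_mono) auto
        also have "\<dots> = \<phi> y"
          by (simp add: \<phi>_def l_def C_def eq inner_left_distrib algebra_simps)
        finally show ?thesis .
      qed
      then have "contact_above T \<phi> ?u (t, x)"
        by (simp add: contact_above_def \<phi>_def eq)
      moreover have "smooth_on ?S \<phi>"
        unfolding \<phi>_def by (rule smooth_on_paraboloid)
      ultimately have "dt \<phi> t x + H t x (dx \<phi> t x) \<le> 0"
        using visc z unfolding viscosity_solution_def by blast
      moreover have "(\<phi> has_derivative (\<lambda>v. l \<bullet> v)) (at (t, x))"
        using paraboloid_has_derivative[of "fm (t, x)" l "(t, x)" C "(t, x)"]
        by (simp add: \<phi>_def[abs_def] zero_prod_def[symmetric])
      note dt_dx_eqI[OF this]
      ultimately have "s * dt fm t x + (1 - s) * dt fp t x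
          + H t x (s *\<^sub>R dx fm t x + (1 - s) *\<^sub>R dx fp t x) \<le> 0"
        by (simp add: l_def a_def b_def)
      \<comment> \<open>Replacing the time derivatives by Hamiltonian values turns the subsolution
        inequality for \<open>\<phi>\<close> into the entropy inequality.\<close>
      moreover have "dt fm t x = - H t x (dx fm t x)" "dt fp t x = - H t x (dx fp t x)"
        using HJ[OF z] by simp_all
      ultimately show "H t x (s *\<^sub>R dx fm t x + (1 - s) *\<^sub>R dx fp t x)
          \<le> s * H t x (dx fm t x) + (1 - s) * H t x (dx fp t x)"
        by simp
    qed
  next
    assume entropy: "\<forall>(t, x) \<in> ?S. fm (t, x) = fp (t, x) \<longrightarrow>
      entropy_condition H t x (dx fm t x) (dx fp t x)"
    have ineqs: "(contact_above T \<phi> ?u (t, x) \<longrightarrow> dt \<phi> t x + H t x (dx \<phi> t x) \<le> 0) \<and>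
        (contact_below T \<phi> ?u (t, x) \<longrightarrow> dt \<phi> t x + H t x (dx \<phi> t x) \<ge> 0)"
      if smooth: "smooth_on ?S \<phi>" and z: "(t, x) \<in> ?S" for \<phi> t x
    proof -
      have "Ck_on 1 ?S \<phi>"
        using smooth by (simp only: smooth_on_def)
      then have "\<phi> differentiable (at (t, x))"
        using z by simp
      note D\<phi> = has_derivative_dt_dx[OF this]
      \<comment> \<open>A differentiable function touching \<open>\<phi>\<close> from either side
        near the point shares its differential, so \<open>\<phi>\<close> inherits the equation
        there.\<close>
      have touch: "dt \<phi> t x + H t x (dx \<phi> t x) = 0"
        if "open U" "(t, x) \<in> U" "f differentiable (at (t, x))" "f (t, x) = \<phi> (t, x)"
          "dt f t x + H t x (dx f t x) = 0"
          "(\<forall>y\<in>U. f y \<le> \<phi> y) \<or> (\<forall>y\<in>U. \<phi> y \<le> f y)" for U f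
      proof -
        note Df = has_derivative_dt_dx[OF that(3)]
        have "(dt \<phi> t x, dx \<phi> t x) = (dt f t x, dx f t x)"
          using that(6)
        proof
          assume "\<forall>y\<in>U. f y \<le> \<phi> y"
          then show ?thesis
            using derivative_of_contact_above_min[OF that(1,2) Df Df D\<phi> that(4,4)] by simp
        next
          assume "\<forall>y\<in>U. \<phi> y \<le> f y"
          then show ?thesis
            using derivative_of_contact_above_min[OF that(1,2) D\<phi> D\<phi> Df that(4,4)[symmetric]] by simp
        qed
        with that(5) show ?thesis
          by simp
      qed
      have cont: "continuous_on ?S fm" "continuous_on ?S fp"
        using diff by (auto intro!: continuous_at_imp_continuous_on differentiable_imp_continuous_within)
      show ?thesis
      proof (intro conjI impI)
        assume above: "contact_above T \<phi> ?u (t, x)"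
        consider "fm (t, x) < fp (t, x)" | "fp (t, x) < fm (t, x)" | "fm (t, x) = fp (t, x)"
          by linarith
        then show "dt \<phi> t x + H t x (dx \<phi> t x) \<le> 0"
        proof cases
          case 1
          \<comment> \<open>On this open set the minimum is \<open>fm\<close>, so
            \<open>\<phi>\<close> touches a single classical solution.\<close>
          let ?U = "?S \<inter> (\<lambda>y. fp y - fm y) -` {0<..}"
          have "open ?U"
            by (intro continuous_open_preimage continuous_on_diff cont S open_greaterThan)
          moreover have "\<forall>y\<in>?U. fm y \<le> \<phi> y"
            using above by (fastforce simp: contact_above_def min_le_iff_disj)
          ultimately show ?thesis
            using touch[OF _ _ diff(1)[OF z] _ HJ(1)[OF z], of ?U] 1 z above
            by (auto simp: contact_above_def)
        next
          case 2
          let ?U = "?S \<inter> (\<lambda>y. fm y - fp y) -` {0<..}"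
          have "open ?U"
            by (intro continuous_open_preimage continuous_on_diff cont S open_greaterThan)
          moreover have "\<forall>y\<in>?U. fp y \<le> \<phi> y"
            using above by (fastforce simp: contact_above_def min_le_iff_disj)
          ultimately show ?thesis
            using touch[OF _ _ diff(2)[OF z] _ HJ(2)[OF z], of ?U] 2 z above
            by (auto simp: contact_above_def)
        next
          case 3
          \<comment> \<open>The endpoints are ordered so that the segment parameter weights
            \<open>fm\<close>, as \<open>s\<close> does in \<open>entropy_condition\<close>.\<close>
          have "(dt \<phi> t x, dx \<phi> t x) \<in> closed_segment (dt fp t x, dx fp t x) (dt fm t x, dx fm t x)"
            using derivative_of_contact_above_min[OF S(1) z Dp[OF z] Dm[OF z] D\<phi>] above 3
            by (auto simp: contact_above_def min.commute)
          then obtain s where s: "0 \<le> s" "s \<le> 1"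
            and dt\<phi>: "dt \<phi> t x = (1 - s) * dt fp t x + s * dt fm t x"
            and dx\<phi>: "dx \<phi> t x = s *\<^sub>R dx fm t x + (1 - s) *\<^sub>R dx fp t x"
            by (auto simp: closed_segment_def add.commute)
          have "H t x (dx \<phi> t x) \<le> s * H t x (dx fm t x) + (1 - s) * H t x (dx fp t x)"
            using entropy z 3 s by (auto simp: entropy_condition_def dx\<phi>)
          moreover have "dt fm t x = - H t x (dx fm t x)" "dt fp t x = - H t x (dx fp t x)"
            using HJ[OF z] by simp_all
          ultimately show ?thesis
            by (simp add: dt\<phi>)
        qed
      next
        assume "contact_below T \<phi> ?u (t, x)"
        \<comment> \<open>Lying below the minimum means lying below both branches; the one attaining
          it at \<open>(t, x)\<close> is touched by \<open>\<phi>\<close>, and \<open>touch\<close>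
          gives equality.\<close>
        then have le: "\<phi> y \<le> fm y" "\<phi> y \<le> fp y" if "y \<in> ?S" for y
          using that by (auto simp: contact_below_def)
        have "fm (t, x) = \<phi> (t, x) \<or> fp (t, x) = \<phi> (t, x)"
          using \<open>contact_below T \<phi> ?u (t, x)\<close> by (auto simp: contact_below_def min_def)
        then have "dt \<phi> t x + H t x (dx \<phi> t x) = 0"
          using touch[OF S(1) z diff(1)[OF z] _ HJ(1)[OF z]] touch[OF S(1) z diff(2)[OF z] _ HJ(2)[OF z]]
            le by blast
        then show "dt \<phi> t x + H t x (dx \<phi> t x) \<ge> 0"
          by simp
      qed
    qed
    then show "viscosity_solution T H ?u"
      unfolding viscosity_solution_def by blast
  qed
qed

end
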